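(* Let $\varphi_e$ and $\varphi_{e_1}$ be two ruled surfaces in $\mathbb{R}^3$ that form a Bertrand surface offset, with offset angle $\theta$ and offset distance $\theta^*$. Then, at corresponding parameters, $$\theta^*=\frac{\delta\cos\theta-\Delta\sin\theta}{\cos\theta+\gamma\sin\theta}-\delta_1 .$$
   Context: Dual numbers are $\bar a=a+\varepsilon a^*$ with $a,a^*\in\mathbb{R}$, $\varepsilon\neq 0$, $\varepsilon^2=0$. For a differentiable real function $f$, $f(x+\varepsilon x^* )=f(x)+\varepsilon x^*f'(x)$; e.g. $\cos(x+\varepsilon x^* )=\cos x-\varepsilon x^*\sin x$, $\sin(x+\varepsilon x^* )=\sin x+\varepsilon x^*\cos x$. Dual vectors are $\tilde a=\vec a+\varepsilon\vec a^*$ with $\vec a,\vec a^*\in\mathbb{R}^3$; scalar and vector products are extended $\varepsilon$-bilinearly. A ruled surface $\varphi_e=\vec c(s)+v\,\vec e(s)$ (all data smooth) is parametrized so that $\langle \vec e,\vec e\rangle=1$, $\langle \vec e',\vec e'\rangle=1$, $\langle \vec c',\vec e'\rangle=0$, where prime is $d/ds$; so $s$ is the arc length of the real indicatrix $\vec e(s)$ and $\vec c$ is the striction line. It is represented by the dual unit vector $\tilde e=\vec e+\varepsilon\,\vec c\times\vec e$. Put $\vec t=\vec e'$, $\vec g=\vec e\times\vec t$; the conical curvature $\gamma$ is defined by $\vec e'=\vec t$, $\vec t'=\gamma\vec g-\vec e$, $\vec g'=-\gamma\vec t$. Put $\Delta=\det(\vec c',\vec e,\vec t)$, $\delta=\langle\vec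 c',\vec e\rangle$. The dual Darboux frame is $\{\tilde e,\tilde t,\tilde g\}$ with $\tilde t=\vec t+\varepsilon\,\vec c\times\vec t$, $\tilde g=\vec g+\varepsilon\,\vec c\times\vec g$. The corresponding objects of a second ruled surface $\varphi_{e_1}$ (with its own parameter $s_1$, derivatives taken with respect to $s_1$) carry the subscript $1$; e.g. $\delta_1=\langle d\vec c_1/ds_1,\vec e_1\rangle$. $\varphi_e$ and $\varphi_{e_1}$ form a Bertrand surface offset if, under a correspondence $s_1=s_1(s)$ between their rulings (differentiable with nonvanishing derivative), $\tilde t=\tilde t_1$ at corresponding parameters. The frames are then related by $\tilde e_1=\cos\bar\theta\,\tilde e-\sin\bar\theta\,\tilde g$, $\tilde t_1=\tilde t$, $\tilde g_1=\sin\bar\theta\,\tilde e+\cos\bar\theta\,\tilde g$, where $\bar\theta=\theta+\varepsilon\theta^*$ ($0\le\theta\le\pi$, $\theta^*\in\mathbb{R}$) is the dual angle between $\tilde e$ and $\tilde e_1$; $\theta$ is the offset angle and $\theta^*$ the offset distance. *)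

theory Defs
  imports "HOL-Analysis.Analysis"
begin

unbundle cross3_syntax

section \<open>Dual numbers and dual vectors\<close>

text \<open>
  \<open>Dual a b\<close> stands for \<open>a + \<epsilon> b\<close> with \<open>\<epsilon>\<^sup>2 = 0\<close>.  Dual numbers are \<open>real dual\<close>,
  dual vectors are \<open>(real^3) dual\<close>.
\<close>

datatype 'a dual = Dual (real_part: 'a) (dual_part: 'a)

instantiation dual :: (minus) minus
begin
definition minus_dual :: "'a dual \<Rightarrow> 'a dual \<Rightarrow> 'a dual" where
  "x - y = Dual (real_part x - real_part y) (dual_part x - dual_part y)"
instance ..
end

definition dual_scale :: "real dual \<Rightarrow> 'a::real_vector dual \<Rightarrow> 'a dual" (infixr \<open>*\<^sub>D\<close> 75) where
  "a *\<^sub>D x = Dual (real_part a *\<^sub>R real_part x)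
                 (real_part a *\<^sub>R dual_part x + dual_part a *\<^sub>R real_part x)"

definition dual_extension :: "(real \<Rightarrow> real) \<Rightarrow> real dual \<Rightarrow> real dual" where
  "dual_extension f x = Dual (f (real_part x)) (dual_part x * deriv f (real_part x))"

section \<open>Ruled surfaces\<close>

text \<open>
  A ruled surface \<open>c s + v *\<^sub>R e s\<close> is given by its striction line \<open>c\<close> and its director \<open>e\<close>,
  both on an open interval \<open>I\<close>.
\<close>

text \<open>All iterated derivatives exist; since \<open>I\<close> is open, this is \<open>C\<^sup>\<infinity>\<close> on \<open>I\<close>.\<close>
definition smooth_curve_on :: "real set \<Rightarrow> (real \<Rightarrow> 'a::real_normed_vector) \<Rightarrow> bool" where
  "smooth_curve_on I f \<longleftrightarrow>
     (\<forall>n. \<forall>s\<in>I. ((\<lambda>g u. vector_derivative g (at u)) ^^ n) f differentiable (at s))"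

definition ruled_surface ::
    "real set \<Rightarrow> (real \<Rightarrow> real^3) \<Rightarrow> (real \<Rightarrow> real^3) \<Rightarrow> bool" where
  "ruled_surface I c e \<longleftrightarrow>
     open I \<and> is_interval I \<and> I \<noteq> {} \<and> smooth_curve_on I c \<and> smooth_curve_on I e \<and>
     (\<forall>s\<in>I. e s \<bullet> e s = 1 \<and>
            vector_derivative e (at s) \<bullet> vector_derivative e (at s) = 1 \<and>
            vector_derivative c (at s) \<bullet> vector_derivative e (at s) = 0)"

definition tvec :: "(real \<Rightarrow> real^3) \<Rightarrow> real \<Rightarrow> real^3" where
  "tvec e s = vector_derivative e (at s)"

definition gvec :: "(real \<Rightarrow> real^3) \<Rightarrow> real \<Rightarrow> real^3" where
  "gvec e s = e s \<times> tvec e s"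

definition conical_curvature :: "(real \<Rightarrow> real^3) \<Rightarrow> real \<Rightarrow> real" where
  "conical_curvature e s =
     (THE k. vector_derivative (tvec e) (at s) = k *\<^sub>R gvec e s - e s \<and>
             vector_derivative (gvec e) (at s) = - k *\<^sub>R tvec e s)"

definition inv_Delta :: "(real \<Rightarrow> real^3) \<Rightarrow> (real \<Rightarrow> real^3) \<Rightarrow> real \<Rightarrow> real" where
  "inv_Delta c e s = det (vector [vector_derivative c (at s), e s, tvec e s] :: real^3^3)"

definition inv_delta :: "(real \<Rightarrow> real^3) \<Rightarrow> (real \<Rightarrow> real^3) \<Rightarrow> real \<Rightarrow> real" where
  "inv_delta c e s = vector_derivative c (at s) \<bullet> e s"

section \<open>The dual Darboux frame and Bertrand offsets\<close>

definition dual_line :: "real^3 \<Rightarrow> real^3 \<Rightarrow> (real^3) dual" where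
  "dual_line p x = Dual x (p \<times> x)"

definition dual_e :: "(real \<Rightarrow> real^3) \<Rightarrow> (real \<Rightarrow> real^3) \<Rightarrow> real \<Rightarrow> (real^3) dual" where
  "dual_e c e s = dual_line (c s) (e s)"

definition dual_t :: "(real \<Rightarrow> real^3) \<Rightarrow> (real \<Rightarrow> real^3) \<Rightarrow> real \<Rightarrow> (real^3) dual" where
  "dual_t c e s = dual_line (c s) (tvec e s)"

definition dual_g :: "(real \<Rightarrow> real^3) \<Rightarrow> (real \<Rightarrow> real^3) \<Rightarrow> real \<Rightarrow> (real^3) dual" where
  "dual_g c e s = dual_line (c s) (gvec e s)"

text \<open>
  \<open>\<sigma>\<close> is the correspondence \<open>s\<^sub>1 = \<sigma> s\<close> between the rulings; the frame of the second surface
  is formed with derivatives in its own parameter and only then evaluated at \<open>\<sigma> s\<close>.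
\<close>
definition bertrand_offset ::
    "real set \<Rightarrow> (real \<Rightarrow> real^3) \<Rightarrow> (real \<Rightarrow> real^3) \<Rightarrow>
     real set \<Rightarrow> (real \<Rightarrow> real^3) \<Rightarrow> (real \<Rightarrow> real^3) \<Rightarrow> (real \<Rightarrow> real) \<Rightarrow> bool" where
  "bertrand_offset I c e I1 c1 e1 \<sigma> \<longleftrightarrow>
     ruled_surface I c e \<and> ruled_surface I1 c1 e1 \<and> bij_betw \<sigma> I I1 \<and>
     (\<forall>s\<in>I. \<sigma> differentiable (at s) \<and> deriv \<sigma> s \<noteq> 0 \<and>
            dual_t c1 e1 (\<sigma> s) = dual_t c e s)"

text \<open>
  The dual angle \<open>\<theta> + \<epsilon> \<theta>\<^sup>*\<close> from \<open>dual_e c e s\<close> to \<open>dual_e c1 e1 s1\<close>, oriented in the dual plane of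
  \<open>dual_e c e s\<close> and \<open>dual_g c e s\<close>.  The cosine alone (the dual scalar product) would not
  determine the sign of the angle, nor the offset distance when \<open>sin \<theta> = 0\<close>.
  For a Bertrand offset the companion relation
  \<open>dual_g c1 e1 s1 = sin \<theta> *\<^sub>D dual_e c e s + cos \<theta> *\<^sub>D dual_g c e s\<close> (dual sine and cosine) follows by
  taking the dual vector product with the common vector \<open>dual_t\<close>, so it is not demanded.
\<close>
definition is_dual_offset_angle ::
    "(real \<Rightarrow> real^3) \<Rightarrow> (real \<Rightarrow> real^3) \<Rightarrow> real \<Rightarrow>
     (real \<Rightarrow> real^3) \<Rightarrow> (real \<Rightarrow> real^3) \<Rightarrow> real \<Rightarrow> real dual \<Rightarrow> bool" where
  "is_dual_offset_angle c e s c1 e1 s1 \<Theta> \<longleftrightarrow>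
     0 \<le> real_part \<Theta> \<and> real_part \<Theta> \<le> pi \<and>
     dual_e c1 e1 s1 =
       dual_extension cos \<Theta> *\<^sub>D dual_e c e s - dual_extension sin \<Theta> *\<^sub>D dual_g c e s"

end

theory Submission
  imports Defs
begin

text \<open>
  Write \<open>w = c\<^sub>1 \<circ> \<sigma> - c\<close> for the vector joining corresponding striction points and \<open>u = e\<^sub>1 \<circ> \<sigma>\<close>.
  The dual parts of \<open>dual_t c\<^sub>1 e\<^sub>1 (\<sigma> s) = dual_t c e s\<close> and of the angle relation show that
  \<open>w = \<theta>\<^sup>* t\<close>: the offset distance is measured along the common central normal
  (lemma \<open>striction_displacement\<close>).  The theorem then comes from differentiating two
  orthogonality relations, and neither \<open>\<theta>\<close> nor \<open>\<theta>\<^sup>*\<close> ever has to be differentiated.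

  Since \<open>e\<^sub>1\<close> is orthogonal to \<open>t\<^sub>1\<close>, and \<open>t\<^sub>1\<close> is \<open>t\<close>, both \<open>u \<bullet> t = 0\<close> and \<open>u \<bullet> w = 0\<close> hold at
  all parameters.  The chain rule gives \<open>u' = \<sigma>' t\<close>, so the derivative of the first relation, with
  \<open>t' = \<gamma> g - e\<close> and \<open>u = cos \<theta> e - sin \<theta> g\<close>, is \<open>\<sigma>' = cos \<theta> + \<gamma> sin \<theta>\<close>; in particular the
  denominator of the formula does not vanish.  With \<open>w' = \<sigma>' c\<^sub>1' - c'\<close>, the derivative of the
  second relation is \<open>\<sigma>' \<theta>\<^sup>* + \<sigma>' \<delta>\<^sub>1 - c' \<bullet> u = 0\<close>.  Here
  \<open>c' \<bullet> u = \<delta> cos \<theta> - \<Delta> sin \<theta>\<close>, because \<open>\<Delta> = c' \<bullet> g\<close>, and division by \<open>\<sigma>'\<close> gives the claim.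
\<close>

section \<open>Orthonormal frames and inner products of curves\<close>

text \<open>
  The product rule, in the form that turns unit length and orthogonality, known on an
  open set of parameters, into the components of a derivative.
\<close>
lemma inner_derivatives_of_constant_inner:
  fixes f h :: "real \<Rightarrow> 'a::real_inner"
  assumes f: "(f has_vector_derivative f') (at s)"
    and h: "(h has_vector_derivative h') (at s)"
    and "open I" "s \<in> I" and const: "\<And>u. u \<in> I \<Longrightarrow> f u \<bullet> h u = k"
  shows "f' \<bullet> h s + f s \<bullet> h' = 0"
proof -
  have "((\<lambda>u. f u \<bullet> h u) has_vector_derivative f s \<bullet> h' + f' \<bullet> h s) (at s)"
    by (rule bounded_bilinear.has_vector_derivative[OF bounded_bilinear_inner f h])
  moreover have "((\<lambda>u. f u \<bullet> h u) has_vector_derivative 0) (at s)"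
    by (rule has_vector_derivative_transform_within_open
        [OF has_vector_derivative_const[of k] \<open>open I\<close> \<open>s \<in> I\<close>]) (simp add: const)
  ultimately show ?thesis
    by (metis add.commute vector_derivative_at)
qed

lemma cross3_orthonormal_frame:
  fixes e t :: "real^3"
  assumes "e \<bullet> e = 1" "t \<bullet> t = 1" "e \<bullet> t = 0"
  shows "(e \<times> t) \<bullet> (e \<times> t) = 1" "t \<times> (e \<times> t) = e" "e \<times> (e \<times> t) = - t"
  using assms by (simp_all add: dot_cross Lagrange inner_commute)

text \<open>
  The vectors \<open>e\<close>, \<open>t\<close>, \<open>e \<times> t\<close> span the space: the remainder \<open>y\<close> of the expansion is both
  orthogonal and parallel to the unit vector \<open>e \<times> t\<close>.
\<close>
lemma cross3_orthonormal_expansion: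
  fixes e t x :: "real^3"
  assumes "e \<bullet> e = 1" "t \<bullet> t = 1" "e \<bullet> t = 0"
  shows "x = (x \<bullet> e) *\<^sub>R e + (x \<bullet> t) *\<^sub>R t + (x \<bullet> (e \<times> t)) *\<^sub>R (e \<times> t)"
proof -
  define y where "y = x - ((x \<bullet> e) *\<^sub>R e + (x \<bullet> t) *\<^sub>R t + (x \<bullet> (e \<times> t)) *\<^sub>R (e \<times> t))"
  note g = cross3_orthonormal_frame(1)[OF assms]
  have ye: "y \<bullet> e = 0" and yt: "y \<bullet> t = 0" and yg: "y \<bullet> (e \<times> t) = 0"
    using assms g unfolding y_def
    by (simp_all add: inner_diff_left inner_add_left dot_cross_self inner_commute[of t e])
  have "y \<times> (e \<times> t) = 0"
    using ye yt by (simp add: Lagrange)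
  then have "y = 0 \<or> e \<times> t = 0"
    using yg norm_and_cross_eq_0 by blast
  then have "y = 0"
    using g by auto
  then show ?thesis
    by (simp add: y_def)
qed

section \<open>The Darboux frame of a ruled surface\<close>

lemma smooth_curve_on_has_derivative:
  assumes "smooth_curve_on I f" "s \<in> I"
  shows "(f has_vector_derivative vector_derivative f (at s)) (at s)"
    and "((\<lambda>u. vector_derivative f (at u)) has_vector_derivative
          vector_derivative (\<lambda>u. vector_derivative f (at u)) (at s)) (at s)"
proof -
  have D: "((\<lambda>g u. vector_derivative g (at u)) ^^ n) f differentiable (at s)" for n
    using assms unfolding smooth_curve_on_def by blast
  show "(f has_vector_derivative vector_derivative f (at s)) (at s)"
    using D[of 0] by (simp add: vector_derivative_works[symmetric])
  show "((\<lambda>u. vector_derivative f (at u)) has_vector_derivative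
          vector_derivative (\<lambda>u. vector_derivative f (at u)) (at s)) (at s)"
    using D[of 1] by (simp add: vector_derivative_works[symmetric])
qed

lemma ruled_surface_derivatives:
  assumes "ruled_surface I c e" "s \<in> I"
  shows "(c has_vector_derivative vector_derivative c (at s)) (at s)"
    and "(e has_vector_derivative tvec e s) (at s)"
    and "(tvec e has_vector_derivative vector_derivative (tvec e) (at s)) (at s)"
proof -
  have tv: "tvec e = (\<lambda>u. vector_derivative e (at u))"
    by (simp add: fun_eq_iff tvec_def)
  have "smooth_curve_on I c" "smooth_curve_on I e"
    using assms unfolding ruled_surface_def by blast+
  then show "(c has_vector_derivative vector_derivative c (at s)) (at s)"
    and "(e has_vector_derivative tvec e s) (at s)"
    and "(tvec e has_vector_derivative vector_derivative (tvec e) (at s)) (at s)"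
    using smooth_curve_on_has_derivative[OF _ \<open>s \<in> I\<close>] unfolding tv by blast+
qed

lemma ruled_surface_frame:
  assumes "ruled_surface I c e" "s \<in> I"
  shows "e s \<bullet> e s = 1" "tvec e s \<bullet> tvec e s = 1" "e s \<bullet> tvec e s = 0"
proof -
  have unit: "open I" "\<And>u. u \<in> I \<Longrightarrow> e u \<bullet> e u = 1" "\<And>u. u \<in> I \<Longrightarrow> tvec e u \<bullet> tvec e u = 1"
    using assms unfolding ruled_surface_def tvec_def by auto
  then show "e s \<bullet> e s = 1" "tvec e s \<bullet> tvec e s = 1"
    using \<open>s \<in> I\<close> by blast+
  have "(e has_vector_derivative tvec e s) (at s)"
    by (rule ruled_surface_derivatives(2)[OF assms])
  from inner_derivatives_of_constant_inner[OF this this unit(1) \<open>s \<in> I\<close> unit(2)]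
  show "e s \<bullet> tvec e s = 0"
    by (simp add: inner_commute)
qed

text \<open>
  The frame equations have exactly one solution \<open>k = t' \<bullet> g\<close>, so the definite description
  defining the conical curvature is meaningful: \<open>t'\<close> has no \<open>t\<close>-component because \<open>t\<close> is a unit
  vector, and its \<open>e\<close>-component is \<open>-1\<close> by differentiating \<open>e \<bullet> t = 0\<close>.
  The equation for \<open>g'\<close> then follows from \<open>g' = e \<times> t'\<close>.
\<close>
lemma derivative_tvec:
  assumes R: "ruled_surface I c e" and s: "s \<in> I"
  shows "vector_derivative (tvec e) (at s) = conical_curvature e s *\<^sub>R gvec e s - e s"
proof -
  define t' where "t' = vector_derivative (tvec e) (at s)"
  define k where "k = t' \<bullet> gvec e s"
  have "open I"
    using R by (simp add: ruled_surface_def)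
  note frame = ruled_surface_frame[OF R s]
  have De: "(e has_vector_derivative tvec e s) (at s)"
    and Dt: "(tvec e has_vector_derivative t') (at s)"
    using ruled_surface_derivatives[OF R s] by (simp_all add: t'_def)
  have "t' \<bullet> tvec e s = 0"
    using inner_derivatives_of_constant_inner[OF Dt Dt \<open>open I\<close> s ruled_surface_frame(2)[OF R]]
    by (simp add: inner_commute)
  moreover have "t' \<bullet> e s = - 1"
    using inner_derivatives_of_constant_inner[OF De Dt \<open>open I\<close> s ruled_surface_frame(3)[OF R]] frame
    by (simp add: inner_commute)
  ultimately have t': "t' = k *\<^sub>R gvec e s - e s"
    using cross3_orthonormal_expansion[OF frame, of t'] by (simp add: k_def gvec_def)
  have "((\<lambda>u. e u \<times> tvec e u) has_vector_derivative
          e s \<times> t' + tvec e s \<times> tvec e s) (at s)"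
    using bounded_bilinear.has_vector_derivative[OF _ De Dt, of "(\<times>)"]
      bilinear_conv_bounded_bilinear bilinear_cross by blast
  then have "(gvec e has_vector_derivative e s \<times> t') (at s)"
    by (simp add: gvec_def[abs_def] cross_refl)
  then have "vector_derivative (gvec e) (at s) = e s \<times> t'"
    by (rule vector_derivative_at)
  also have "\<dots> = - k *\<^sub>R tvec e s"
    using cross3_orthonormal_frame(3)[OF frame]
    by (simp add: t' gvec_def Cross3.right_diff_distrib cross_mult_right cross_refl)
  finally have g': "vector_derivative (gvec e) (at s) = - k *\<^sub>R tvec e s" .
  have "gvec e s \<noteq> 0"
    using cross3_orthonormal_frame(1)[OF frame] by (auto simp: gvec_def)
  then have "conical_curvature e s = k"
    unfolding conical_curvature_def
    by (intro the_equality) (use t' g' in \<open>auto simp: t'_def\<close>)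
  then show ?thesis
    using t' by (simp add: t'_def)
qed

lemma inv_Delta_eq_inner: "inv_Delta c e s = vector_derivative c (at s) \<bullet> gvec e s"
  by (simp add: inv_Delta_def gvec_def dot_cross_det)

section \<open>Bertrand offsets\<close>

lemma dual_offset_angle_parts:
  assumes "is_dual_offset_angle c e s c1 e1 s1 (Dual \<theta> \<theta>d)"
  shows "e1 s1 = cos \<theta> *\<^sub>R e s - sin \<theta> *\<^sub>R gvec e s"
    and "c1 s1 \<times> e1 s1 = c s \<times> e1 s1 - \<theta>d *\<^sub>R (sin \<theta> *\<^sub>R e s + cos \<theta> *\<^sub>R gvec e s)"
proof -
  have [simp]: "deriv cos \<theta> = - sin \<theta>" "deriv sin \<theta> = cos \<theta>"
    by (auto intro!: DERIV_imp_deriv derivative_eq_intros)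
  show e1: "e1 s1 = cos \<theta> *\<^sub>R e s - sin \<theta> *\<^sub>R gvec e s"
    using assms
    by (simp add: is_dual_offset_angle_def dual_e_def dual_g_def dual_line_def dual_scale_def
        dual_extension_def minus_dual_def)
  have "c1 s1 \<times> e1 s1 = cos \<theta> *\<^sub>R (c s \<times> e s) - sin \<theta> *\<^sub>R (c s \<times> gvec e s)
      - \<theta>d *\<^sub>R (sin \<theta> *\<^sub>R e s + cos \<theta> *\<^sub>R gvec e s)"
    using assms
    by (simp add: is_dual_offset_angle_def dual_e_def dual_g_def dual_line_def dual_scale_def
        dual_extension_def minus_dual_def algebra_simps)
  then show "c1 s1 \<times> e1 s1 = c s \<times> e1 s1 - \<theta>d *\<^sub>R (sin \<theta> *\<^sub>R e s + cos \<theta> *\<^sub>R gvec e s)"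
    by (simp add: e1 Cross3.right_diff_distrib cross_mult_right)
qed

text \<open>
  The equal moments of the common line \<open>dual_t\<close> make the displacement parallel to \<open>t\<close>; its length
  is read off from the moments of \<open>e\<^sub>1\<close>, which involve the unit vector
  \<open>e\<^sub>1 \<times> t = sin \<theta> e + cos \<theta> g\<close>.
\<close>
lemma striction_displacement:
  assumes frame: "e s \<bullet> e s = 1" "tvec e s \<bullet> tvec e s = 1" "e s \<bullet> tvec e s = 0"
    and t: "dual_t c1 e1 s1 = dual_t c e s"
    and ang: "is_dual_offset_angle c e s c1 e1 s1 (Dual \<theta> \<theta>d)"
  shows "c1 s1 - c s = \<theta>d *\<^sub>R tvec e s"
proof -
  define w where "w = c1 s1 - c s"
  define h where "h = sin \<theta> *\<^sub>R e s + cos \<theta> *\<^sub>R gvec e s"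
  note e1 = dual_offset_angle_parts(1)[OF ang]
  have "w \<times> tvec e s = 0"
    using t by (auto simp: w_def dual_t_def dual_line_def Cross3.left_diff_distrib)
  then have "tvec e s \<times> (w \<times> tvec e s) = 0"
    by simp
  then have w: "w = (w \<bullet> tvec e s) *\<^sub>R tvec e s"
    using frame by (simp add: Lagrange inner_commute)
  have "e s \<bullet> gvec e s = 0"
    by (simp add: gvec_def dot_cross_self)
  then have "h \<bullet> h = (sin \<theta>)\<^sup>2 + (cos \<theta>)\<^sup>2"
    using frame(1) cross3_orthonormal_frame(1)[OF frame]
    by (simp add: h_def gvec_def[symmetric] inner_add_left inner_add_right inner_commute
        power2_eq_square)
  then have "h \<noteq> 0"
    by auto
  have te1: "tvec e s \<times> e1 s1 = - h"
    using cross3_orthonormal_frame(2)[OF frame]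
    by (simp add: e1 h_def gvec_def Cross3.right_diff_distrib cross_mult_right
        cross_skew[of "tvec e s" "e s"])
  have "w \<times> e1 s1 = - (\<theta>d *\<^sub>R h)"
    using dual_offset_angle_parts(2)[OF ang]
    by (simp add: w_def h_def Cross3.left_diff_distrib)
  moreover have "w \<times> e1 s1 = - ((w \<bullet> tvec e s) *\<^sub>R h)"
    by (subst w) (simp add: cross_mult_left te1)
  ultimately have "w \<bullet> tvec e s = \<theta>d"
    using \<open>h \<noteq> 0\<close> by simp
  then show ?thesis
    using w by (simp add: w_def)
qed

theorem theorem4p4:
  fixes I I1 :: "real set"
    and c e c1 e1 :: "real \<Rightarrow> real^3"
    and \<sigma> :: "real \<Rightarrow> real"
    and \<theta> \<theta>d :: "real \<Rightarrow> real"
  assumes "bertrand_offset I c e I1 c1 e1 \<sigma>"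
    and "\<And>s. s \<in> I \<Longrightarrow> is_dual_offset_angle c e s c1 e1 (\<sigma> s) (Dual (\<theta> s) (\<theta>d s))"
  shows "\<forall>s\<in>I. \<theta>d s =
      (inv_delta c e s * cos (\<theta> s) - inv_Delta c e s * sin (\<theta> s)) /
      (cos (\<theta> s) + conical_curvature e s * sin (\<theta> s)) - inv_delta c1 e1 (\<sigma> s)"
proof
  fix s assume s: "s \<in> I"
  have R: "ruled_surface I c e" and R1: "ruled_surface I1 c1 e1"
    and I1: "\<And>u. u \<in> I \<Longrightarrow> \<sigma> u \<in> I1"
    and \<sigma>: "\<sigma> differentiable (at s)" "deriv \<sigma> s \<noteq> 0"
    and dt: "\<And>u. u \<in> I \<Longrightarrow> dual_t c1 e1 (\<sigma> u) = dual_t c e u"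
    using assms(1) s unfolding bertrand_offset_def by (auto dest: bij_betwE)
  have "open I"
    using R by (simp add: ruled_surface_def)
  have t1: "tvec e1 (\<sigma> u) = tvec e u" if "u \<in> I" for u
    using dt[OF that] by (simp add: dual_t_def dual_line_def)
  note frame = ruled_surface_frame[OF R s]
  have disp: "c1 (\<sigma> u) - c u = \<theta>d u *\<^sub>R tvec e u" if "u \<in> I" for u
    using striction_displacement[OF ruled_surface_frame[OF R that] dt[OF that] assms(2)[OF that]] .
  note e1 = dual_offset_angle_parts(1)[OF assms(2)[OF s]]
  define r where "r = deriv \<sigma> s"
  have orth: "e1 (\<sigma> u) \<bullet> tvec e u = 0" if "u \<in> I" for u
    using ruled_surface_frame(3)[OF R1 I1[OF that]] t1[OF that] by simp
  have D\<sigma>: "(\<sigma> has_vector_derivative r) (at s)"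
    using \<sigma>(1) by (simp add: r_def DERIV_deriv_iff_real_differentiable[symmetric]
        has_real_derivative_iff_has_vector_derivative[symmetric])
  have De1: "((\<lambda>u. e1 (\<sigma> u)) has_vector_derivative r *\<^sub>R tvec e s) (at s)"
    using vector_diff_chain_at[OF D\<sigma> ruled_surface_derivatives(2)[OF R1 I1[OF s]]] t1[OF s]
    by (simp add: o_def)
  have Dw: "((\<lambda>u. c1 (\<sigma> u) - c u) has_vector_derivative
      r *\<^sub>R vector_derivative c1 (at (\<sigma> s)) - vector_derivative c (at s)) (at s)"
    using has_vector_derivative_diff
      [OF vector_diff_chain_at[OF D\<sigma> ruled_surface_derivatives(1)[OF R1 I1[OF s]]]
        ruled_surface_derivatives(1)[OF R s]]
    by (simp add: o_def)
  have eg: "e s \<bullet> gvec e s = 0" "gvec e s \<bullet> gvec e s = 1"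
    using cross3_orthonormal_frame(1)[OF frame] by (simp_all add: gvec_def dot_cross_self)
  \<comment> \<open>The derivative of \<open>u \<bullet> t = 0\<close>, where \<open>u' \<bullet> t = \<sigma>'\<close>.\<close>
  have "r + e1 (\<sigma> s) \<bullet> (conical_curvature e s *\<^sub>R gvec e s - e s) = 0"
    using inner_derivatives_of_constant_inner
      [OF De1 ruled_surface_derivatives(3)[OF R s] \<open>open I\<close> s orth] frame(2)
    by (simp add: derivative_tvec[OF R s])
  then have r: "r = cos (\<theta> s) + conical_curvature e s * sin (\<theta> s)"
    using eg frame(1)
    by (simp add: e1 inner_diff_left inner_diff_right inner_commute algebra_simps)
  have "e1 (\<sigma> u) \<bullet> (c1 (\<sigma> u) - c u) = 0" if "u \<in> I" for u
    using orth[OF that] disp[OF that] by simp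
  \<comment> \<open>The derivative of \<open>u \<bullet> w = 0\<close>, where \<open>u' \<bullet> w = \<sigma>' t \<bullet> \<theta>\<^sup>* t = \<sigma>' \<theta>\<^sup>*\<close>.\<close>
  from inner_derivatives_of_constant_inner[OF De1 Dw \<open>open I\<close> s this]
  have "r * \<theta>d s + r * inv_delta c1 e1 (\<sigma> s) - e1 (\<sigma> s) \<bullet> vector_derivative c (at s) = 0"
    using disp[OF s] frame(2)
    by (simp add: inv_delta_def inner_diff_right inner_commute algebra_simps)
  moreover have "e1 (\<sigma> s) \<bullet> vector_derivative c (at s) =
      inv_delta c e s * cos (\<theta> s) - inv_Delta c e s * sin (\<theta> s)"
    by (simp add: e1 inner_diff_left inner_diff_right inv_delta_def inv_Delta_eq_inner
        inner_commute)
  ultimately have "r * (\<theta>d s + inv_delta c1 e1 (\<sigma> s)) =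
      inv_delta c e s * cos (\<theta> s) - inv_Delta c e s * sin (\<theta> s)"
    by (simp add: algebra_simps)
  then have "\<theta>d s = (inv_delta c e s * cos (\<theta> s) - inv_Delta c e s * sin (\<theta> s)) / r
      - inv_delta c1 e1 (\<sigma> s)"
    using \<sigma>(2) by (simp add: r_def field_simps)
  then show "\<theta>d s =
      (inv_delta c e s * cos (\<theta> s) - inv_Delta c e s * sin (\<theta> s)) /
      (cos (\<theta> s) + conical_curvature e s * sin (\<theta> s)) - inv_delta c1 e1 (\<sigma> s)"
    by (simp add: r)
qed

end
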